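(* For every wheel-graph instance (any $n\ge4$ and $\mu\in(0,1)$), there exists a single E-cut such that the optimal value of the relaxed master problem RMP augmented with this E-cut equals $Z^*$, the optimal value of the VRPSD instance under the optimal restocking policy.
   Context: **Wheel-graph instance.** Customers $N=\{1,\dots,n\}$, $n\ge4$, depot $0$. Let $E_1=\{\{k,k+1\}:1\le k\le n-1\}\cup\{\{n,1\}\}$ and $E_2=E(N)\setminus E_1$, where $E(S)$ denotes all edges with both endpoints in $S$. Costs: $c_{0,i}=1$; $c_{i,j}=1$ if $\{i,j\}\in E_1$, $c_{i,j}=2$ if $\{i,j\}\in E_2$. Demands $\xi_i\sim\text{Bern}(\mu)$ are independent, $\mu\in(0,1)$. Capacity $Q=n-1$. Exactly one route is used ($M=\{1\}$), with load factor $f\ge n\mu/Q$, so feasible solutions $x$ are exactly the edge-multiplicity vectors of routes $(0,p,0)$ with $p$ a permutation of $N$. Penalties $b^F=b^P=0$: failure cost $c^F_i=2$, preventive return cost $c^P_{i,j}=2-c_{i,j}$ for customers $i\neq j$, and $c^P_{0,j}=0$. **OR recourse.** Let $\Psi(s,q)=\max\{\lceil(s-q)/Q\rceil,0\}$. For a path (nonempty sequence of distinct customers) $p=(i_1,\dots,i_t)$, $i_0=0$, $q\in\{0,\dots,Q\}$: $F^p_{i_t}(q)=0$ and for $j<t$, $F^p_{i_j}(q)=\min\{H^p_{i_{j+1}}(q),c^P_{i_j,i_{j+1}}+H^p_{i_{j+1}}(Q)\}$ with $H^p_{i}(q)=\mathbb{E}[c^F_i\Psi(\xi_i,q)+F^p_i(\Psi(\xi_i,q)Q+q-\xi_i)]$.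 $\mathcal{Q}^{\text{OR}}_p$ is the minimum of $F^p_{i_0}(Q)$ over $p$ and its reversal. $Z^*$ is the minimum over feasible $x$, with route $(0,p,0)$, of $\sum_ec_ex_e+\mathcal{Q}^{\text{OR}}_p$. **RMP.** Minimize $\sum_ec_ex_e+\sum_{i\in N}\theta_i$ over feasible (integer) $x$ and $\theta\in\mathbb{R}^N_{\ge0}$. **E-cut.** Let $\mathcal{P}$ be the set of feasible paths (here, all paths). For nonempty $S\subseteq N$ and $E_S\subseteq E(S)$, let $\bar\Pi(E_S,m)$ be the set of all sets of $m$ feasible paths in the graph $(S,E_S)$ (single-customer paths included) whose customer sets partition $S$; $\bar m(E_S)=\min\{m:\bar\Pi(E_S,m)\ne\emptyset\}$; $\bar{\mathcal{L}}(E_S,m)=\min_{\pi\in\bar\Pi(E_S,m)}\sum_{p\in\pi}\mathcal{Q}^{\text{OR}}_p$. An E-cut is an inequality $\sum_{i\in S}\theta_i\ge\mathcal{L}_{E_S}(\sum_{e\in E_S}x_e-|S|+m_{E_S}+1)$ for some such $S,E_S$, integer $1\le m_{E_S}\le\bar m(E_S)$ and $0\le\mathcal{L}_{E_S}\le\bar{\mathcal{L}}(E_S,m_{E_S})$. *)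

theory Defs
  imports "HOL-Probability.Probability" "HOL-Combinatorics.Multiset_Permutations"
begin

definition customers :: "nat \<Rightarrow> nat set" where
  "customers n = {1..n}"

definition edges_within :: "nat set \<Rightarrow> nat set set" where
  "edges_within S = {e. e \<subseteq> S \<and> card e = 2}"

definition rim_edges :: "nat \<Rightarrow> nat set set" where
  "rim_edges n = {{k, k + 1} | k. 1 \<le> k \<and> k \<le> n - 1} \<union> {{n, 1}}"

definition chord_edges :: "nat \<Rightarrow> nat set set" where
  "chord_edges n = edges_within (customers n) - rim_edges n"

text \<open>Vertex \<open>0\<close> is the depot; its edges are not chords and therefore cost 1.\<close>

definition edge_cost :: "nat \<Rightarrow> nat set \<Rightarrow> real" where
  "edge_cost n e = (if e \<in> chord_edges n then 2 else 1)"

definition capacity :: "nat \<Rightarrow> int" where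
  "capacity n = int n - 1"

definition demands :: "nat \<Rightarrow> real \<Rightarrow> (nat \<Rightarrow> int) pmf" where
  "demands n \<mu> = Pi_pmf (customers n) 0 (\<lambda>_. map_pmf of_bool (bernoulli_pmf \<mu>))"

definition failure_cost :: "nat \<Rightarrow> real" where
  "failure_cost i = 2"

definition preventive_cost :: "nat \<Rightarrow> nat \<Rightarrow> nat \<Rightarrow> real" where
  "preventive_cost n i j = (if i = 0 then 0 else 2 - edge_cost n {i, j})"

text \<open>The load factor \<open>f\<close> bounds the expected demand on a path relative to the capacity.\<close>

definition feasible_path :: "nat \<Rightarrow> real \<Rightarrow> real \<Rightarrow> nat list \<Rightarrow> bool" where
  "feasible_path n \<mu> f p \<longleftrightarrow>
     p \<noteq> [] \<and> distinct p \<and> set p \<subseteq> customers n \<and>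
     (\<Sum>i\<in>set p. measure_pmf.expectation (demands n \<mu>) (\<lambda>\<xi>. real_of_int (\<xi> i)))
       \<le> f * real_of_int (capacity n)"

lemma expected_demand:
  assumes "i \<in> customers n" "0 \<le> \<mu>" "\<mu> \<le> 1"
  shows "measure_pmf.expectation (demands n \<mu>) (\<lambda>\<xi>. real_of_int (\<xi> i)) = \<mu>"
proof -
  have marginal: "map_pmf (\<lambda>\<xi>. \<xi> i) (demands n \<mu>) = map_pmf of_bool (bernoulli_pmf \<mu>)"
    unfolding demands_def using assms(1) by (subst Pi_pmf_component) (auto simp: customers_def)
  have "measure_pmf.expectation (demands n \<mu>) (\<lambda>\<xi>. real_of_int (\<xi> i))
      = measure_pmf.expectation (map_pmf (\<lambda>\<xi>. \<xi> i) (demands n \<mu>)) real_of_int"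
    by simp
  also have "\<dots> = measure_pmf.expectation (map_pmf of_bool (bernoulli_pmf \<mu>)) real_of_int"
    by (simp only: marginal)
  also have "\<dots> = \<mu>"
    using assms(2,3) by simp
  finally show ?thesis .
qed

lemma feasible_path_iff:
  assumes "n \<ge> 2" "0 \<le> \<mu>" "\<mu> \<le> 1" "f \<ge> real n * \<mu> / real_of_int (capacity n)"
  shows "feasible_path n \<mu> f p \<longleftrightarrow> p \<noteq> [] \<and> distinct p \<and> set p \<subseteq> customers n"
proof -
  have "(\<Sum>i\<in>set p. measure_pmf.expectation (demands n \<mu>) (\<lambda>\<xi>. real_of_int (\<xi> i)))
      \<le> f * real_of_int (capacity n)" if p: "set p \<subseteq> customers n"
  proof -
    have "(\<Sum>i\<in>set p. measure_pmf.expectation (demands n \<mu>) (\<lambda>\<xi>. real_of_int (\<xi> i)))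
        = real (card (set p)) * \<mu>"
      using p assms(2,3) by (simp add: expected_demand subset_iff)
    also have "\<dots> \<le> real n * \<mu>"
      using card_mono[OF _ p] assms(2) by (intro mult_right_mono) (auto simp: customers_def)
    also have "\<dots> \<le> f * real_of_int (capacity n)"
      using assms(1,4) by (simp add: capacity_def divide_simps)
    finally show ?thesis .
  qed
  then show ?thesis by (auto simp: feasible_path_def)
qed

definition walk_edges :: "nat list \<Rightarrow> nat set list" where
  "walk_edges w = map (\<lambda>(i, j). {i, j}) (zip w (tl w))"

definition route_vector :: "nat list \<Rightarrow> nat set \<Rightarrow> nat" where
  "route_vector p e = count_list (walk_edges (0 # p @ [0])) e"

definition is_solution :: "nat \<Rightarrow> real \<Rightarrow> real \<Rightarrow> (nat set \<Rightarrow> nat) \<Rightarrow> nat list \<Rightarrow> bool" where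
  "is_solution n \<mu> f x p \<longleftrightarrow>
     p \<in> permutations_of_set (customers n) \<and> feasible_path n \<mu> f p \<and> x = route_vector p"

definition feasible_solutions :: "nat \<Rightarrow> real \<Rightarrow> real \<Rightarrow> (nat set \<Rightarrow> nat) set" where
  "feasible_solutions n \<mu> f = {x. \<exists>p. is_solution n \<mu> f x p}"

definition travel_cost :: "nat \<Rightarrow> (nat set \<Rightarrow> nat) \<Rightarrow> real" where
  "travel_cost n x = (\<Sum>e\<in>edges_within {0..n}. edge_cost n e * real (x e))"

definition Psi :: "nat \<Rightarrow> int \<Rightarrow> int \<Rightarrow> int" where
  "Psi n s q = max \<lceil>real_of_int (s - q) / real_of_int (capacity n)\<rceil> 0"

text \<open>\<open>visit_cost n \<mu> G i q\<close> is $H^p_i(q)$ when the cost-to-go $F^p_i$ is \<open>G\<close>, and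
  \<open>cost_to_go n \<mu> ks i q\<close> is $F^p_i(q)$ when \<open>ks\<close> lists the vertices following
  \<open>i\<close> on \<open>p\<close>.\<close>

definition visit_cost :: "nat \<Rightarrow> real \<Rightarrow> (int \<Rightarrow> real) \<Rightarrow> nat \<Rightarrow> int \<Rightarrow> real" where
  "visit_cost n \<mu> G i q =
     measure_pmf.expectation (demands n \<mu>)
       (\<lambda>\<xi>. failure_cost i * real_of_int (Psi n (\<xi> i) q)
            + G (Psi n (\<xi> i) q * capacity n + q - \<xi> i))"

primrec cost_to_go :: "nat \<Rightarrow> real \<Rightarrow> nat list \<Rightarrow> nat \<Rightarrow> int \<Rightarrow> real" where
  "cost_to_go n \<mu> [] i q = 0"
| "cost_to_go n \<mu> (k # ks) i q =
     min (visit_cost n \<mu> (cost_to_go n \<mu> ks k) k q)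
         (preventive_cost n i k + visit_cost n \<mu> (cost_to_go n \<mu> ks k) k (capacity n))"

definition recourse :: "nat \<Rightarrow> real \<Rightarrow> nat list \<Rightarrow> real" where
  "recourse n \<mu> p =
     min (cost_to_go n \<mu> p 0 (capacity n)) (cost_to_go n \<mu> (rev p) 0 (capacity n))"

definition vrpsd_value :: "nat \<Rightarrow> real \<Rightarrow> real \<Rightarrow> real" where
  "vrpsd_value n \<mu> f = Min {travel_cost n x + recourse n \<mu> p | x p. is_solution n \<mu> f x p}"

definition path_partitions ::
    "nat \<Rightarrow> real \<Rightarrow> real \<Rightarrow> nat set \<Rightarrow> nat set set \<Rightarrow> nat \<Rightarrow> nat list set set" where
  "path_partitions n \<mu> f S ES m =
     {\<pi>. finite \<pi> \<and> card \<pi> = m \<and>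
         (\<forall>p\<in>\<pi>. feasible_path n \<mu> f p \<and> successively (\<lambda>i j. {i, j} \<in> ES) p) \<and>
         disjoint_family_on set \<pi> \<and> (\<Union>p\<in>\<pi>. set p) = S}"

definition min_paths :: "nat \<Rightarrow> real \<Rightarrow> real \<Rightarrow> nat set \<Rightarrow> nat set set \<Rightarrow> nat" where
  "min_paths n \<mu> f S ES = (LEAST m. path_partitions n \<mu> f S ES m \<noteq> {})"

text \<open>The minimum over the empty set is \<open>\<infinity>\<close>: there are no partitions into
  fewer than \<open>min_paths n \<mu> f S ES\<close> paths.\<close>

definition recourse_bound ::
    "nat \<Rightarrow> real \<Rightarrow> real \<Rightarrow> nat set \<Rightarrow> nat set set \<Rightarrow> nat \<Rightarrow> ereal" where
  "recourse_bound n \<mu> f S ES m =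
     (INF \<pi>\<in>path_partitions n \<mu> f S ES m. ereal (\<Sum>p\<in>\<pi>. recourse n \<mu> p))"

definition is_E_cut ::
    "nat \<Rightarrow> real \<Rightarrow> real \<Rightarrow> nat set \<Rightarrow> nat set set \<Rightarrow> nat \<Rightarrow> real \<Rightarrow> bool" where
  "is_E_cut n \<mu> f S ES m L \<longleftrightarrow>
     S \<noteq> {} \<and> S \<subseteq> customers n \<and> ES \<subseteq> edges_within S \<and>
     1 \<le> m \<and> m \<le> min_paths n \<mu> f S ES \<and>
     0 \<le> L \<and> ereal L \<le> recourse_bound n \<mu> f S ES m"

definition satisfies_E_cut ::
    "nat set \<Rightarrow> nat set set \<Rightarrow> nat \<Rightarrow> real \<Rightarrow> (nat set \<Rightarrow> nat) \<Rightarrow> (nat \<Rightarrow> real) \<Rightarrow> bool" where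
  "satisfies_E_cut S ES m L x \<theta> \<longleftrightarrow>
     (\<Sum>i\<in>S. \<theta> i) \<ge> L * ((\<Sum>e\<in>ES. real (x e)) - real (card S) + real m + 1)"

definition rmp_points ::
    "nat \<Rightarrow> real \<Rightarrow> real \<Rightarrow> ((nat set \<Rightarrow> nat) \<times> (nat \<Rightarrow> real)) set" where
  "rmp_points n \<mu> f = {(x, \<theta>). x \<in> feasible_solutions n \<mu> f \<and> (\<forall>i\<in>customers n. 0 \<le> \<theta> i)}"

definition rmp_objective :: "nat \<Rightarrow> (nat set \<Rightarrow> nat) \<Rightarrow> (nat \<Rightarrow> real) \<Rightarrow> real" where
  "rmp_objective n x \<theta> = travel_cost n x + (\<Sum>i\<in>customers n. \<theta> i)"

definition is_minimum :: "real set \<Rightarrow> real \<Rightarrow> bool" where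
  "is_minimum A v \<longleftrightarrow> v \<in> A \<and> (\<forall>u\<in>A. v \<le> u)"

end

theory Submission
  imports Defs
begin

text \<open>The single E-cut takes \<open>S\<close> to be all customers, \<open>E\<^sub>S\<close> the rim, \<open>m = 1\<close> and \<open>L\<close> the
  cheapest recourse of a Hamiltonian path along the rim. A route with \<open>R\<close> rim edges has travel
  cost \<open>2n - R\<close>. If \<open>R = n - 1\<close>, the cut forces \<open>\<Sum>\<theta> \<ge> L\<close>, which is what the true recourse
  allows. If \<open>R \<le> n - 2\<close>, the cut is void, but the route already costs one unit more in travel,
  and \<open>L \<le> 1\<close>: restocking right after the first customer costs at most 1, and a full vehicle
  then serves the remaining \<open>n - 1 = Q\<close> unit demands without failure.\<close>

section \<open>Edge multiplicities, rim edges and the travel cost of a route\<close>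

lemma sum_count_list:
  fixes g :: "'a \<Rightarrow> 'b::comm_semiring_1"
  assumes "finite A"
  shows "(\<Sum>e\<in>A. g e * of_nat (count_list xs e)) = (\<Sum>x\<leftarrow>xs. if x \<in> A then g x else 0)"
proof (induction xs)
  case (Cons a xs)
  have "(\<Sum>e\<in>A. g e * of_nat (count_list (a # xs) e))
      = (\<Sum>e\<in>A. (if e = a then g e else 0) + g e * of_nat (count_list xs e))"
    by (intro sum.cong) (auto simp: algebra_simps)
  also have "\<dots> = (if a \<in> A then g a else 0) + (\<Sum>e\<in>A. g e * of_nat (count_list xs e))"
    using assms by (simp add: sum.distrib)
  finally show ?case using Cons.IH by simp
qed simp

lemma walk_edges_simps [simp]:
  "walk_edges [] = []"
  "walk_edges [i] = []"
  "walk_edges (i # j # w) = {i, j} # walk_edges (j # w)"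
  by (simp_all add: walk_edges_def)

lemma walk_edges_snoc:
  "w \<noteq> [] \<Longrightarrow> walk_edges (w @ [k]) = walk_edges w @ [{last w, k}]"
  by (induction w rule: induct_list012) auto

lemma walk_edges_closed:
  assumes "p \<noteq> []"
  shows "walk_edges (i # p @ [k]) = {i, hd p} # walk_edges p @ [{last p, k}]"
  using assms walk_edges_snoc[of p k] by (cases p) auto

lemma length_walk_edges: "length (walk_edges w) = length w - 1"
  by (simp add: walk_edges_def)

text \<open>Links the edge list, on which rim edges are counted, to the \<open>successively\<close>
  condition in \<open>path_partitions\<close>.\<close>

lemma walk_edges_subset_iff:
  "set (walk_edges w) \<subseteq> A \<longleftrightarrow> successively (\<lambda>i j. {i, j} \<in> A) w"
  by (induction w rule: induct_list012) auto

lemma walk_edges_within: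
  "distinct w \<Longrightarrow> set w \<subseteq> V \<Longrightarrow> set (walk_edges w) \<subseteq> edges_within V"
  by (induction w rule: induct_list012) (auto simp: edges_within_def)

lemma edges_within_finite: "finite V \<Longrightarrow> finite (edges_within V)"
  by (rule finite_subset[of _ "Pow V"]) (auto simp: edges_within_def)

lemma rim_edges_within: "n \<ge> 2 \<Longrightarrow> rim_edges n \<subseteq> edges_within (customers n)"
  by (auto simp: rim_edges_def edges_within_def customers_def)

lemma rim_edges_finite: "n \<ge> 2 \<Longrightarrow> finite (rim_edges n)"
  using finite_subset[OF rim_edges_within edges_within_finite] by (simp add: customers_def)

lemma successively_rim_upt: "successively (\<lambda>i j. {i, j} \<in> rim_edges n) [1..<Suc n]"
proof (rule successively_conv_nth[THEN iffD2], intro allI impI)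
  fix i assume "Suc i < length [1..<Suc n]"
  then show "{[1..<Suc n] ! i, [1..<Suc n] ! Suc i} \<in> rim_edges n"
    \<comment> \<open>The entry at position \<open>i\<close> is \<open>Suc i\<close>, hence this
      witness for \<open>k\<close>.\<close>
    by (auto simp: rim_edges_def nth_append intro!: exI[of _ "Suc i"] simp del: upt_Suc)
qed

lemma count_rim_edges:
  assumes "n \<ge> 2" and p: "p \<in> permutations_of_set (customers n)"
  shows "(\<Sum>e\<in>rim_edges n. real (route_vector p e))
       = real (length (filter (\<lambda>e. e \<in> rim_edges n) (walk_edges p)))"
proof -
  have ne: "p \<noteq> []"
    using assms by (auto simp: customers_def permutations_of_set_def)
  have depot: "{0, v} \<notin> rim_edges n" "{v, 0} \<notin> rim_edges n" for v
    using rim_edges_within[OF \<open>n \<ge> 2\<close>] by (auto simp: edges_within_def customers_def)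
  have "(\<Sum>e\<in>rim_edges n. real (route_vector p e))
      = (\<Sum>e\<leftarrow>walk_edges (0 # p @ [0]). if e \<in> rim_edges n then 1 else 0)"
    using sum_count_list[OF rim_edges_finite[OF \<open>n \<ge> 2\<close>], of "\<lambda>_. 1::real"]
    by (simp add: route_vector_def)
  also have "\<dots> = (\<Sum>e\<leftarrow>walk_edges p. if e \<in> rim_edges n then 1 else 0)"
    using depot by (simp add: walk_edges_closed[OF ne])
  also have "\<dots> = real (length (filter (\<lambda>e. e \<in> rim_edges n) (walk_edges p)))"
    by (simp add: sum_list_map_filter'[symmetric] sum_list_triv)
  finally show ?thesis .
qed

text \<open>The two depot edges cost 1 each. Each of the n - 1 inner edges costs 2, less 1 if it
  lies on the rim. The total is 2 + 2(n - 1) minus the number of rim edges.\<close>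

lemma travel_cost_route_vector:
  assumes "n \<ge> 2" and p: "p \<in> permutations_of_set (customers n)"
  shows "travel_cost n (route_vector p)
       = 2 * real n - (\<Sum>e\<in>rim_edges n. real (route_vector p e))"
proof -
  have ne: "p \<noteq> []" and d: "distinct p" and s: "set p = customers n"
    using assms by (auto simp: customers_def permutations_of_set_def)
  have len: "length p = n"
    using d s distinct_card[of p] by (simp add: customers_def)
  \<comment> \<open>As the end customers differ from 0, both depot edges are two-element sets and
    occur in the sum of \<open>travel_cost\<close>.\<close>
  have ends: "hd p \<in> {1..n}" "last p \<in> {1..n}"
    using ne s hd_in_set[of p] last_in_set[of p] by (auto simp: customers_def)
  have inner: "set (walk_edges p) \<subseteq> edges_within (customers n)"
    using d s by (simp add: walk_edges_within)
  have "edges_within (customers n) \<subseteq> edges_within {0..n}"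
    by (auto simp: edges_within_def customers_def)
  with inner ends have sub: "set (walk_edges (0 # p @ [0])) \<subseteq> edges_within {0..n}"
    by (auto simp: walk_edges_closed[OF ne] edges_within_def)
  have depot: "edge_cost n {0, v} = 1" "edge_cost n {v, 0} = 1" for v
    by (auto simp: edge_cost_def chord_edges_def edges_within_def customers_def)
  have inner_cost: "(\<Sum>e\<leftarrow>es. edge_cost n e)
      = 2 * real (length es) - real (length (filter (\<lambda>e. e \<in> rim_edges n) es))"
    if "set es \<subseteq> edges_within (customers n)" for es
    using that by (induction es) (auto simp: edge_cost_def chord_edges_def)
  have "travel_cost n (route_vector p) = (\<Sum>e\<leftarrow>walk_edges (0 # p @ [0]). edge_cost n e)"
    unfolding travel_cost_def route_vector_def
    using sub by (subst sum_count_list) (auto intro!: edges_within_finite arg_cong[of _ _ sum_list])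
  also have "\<dots> = 2 + (\<Sum>e\<leftarrow>walk_edges p. edge_cost n e)"
    using depot by (simp add: walk_edges_closed[OF ne])
  also have "(\<Sum>e\<leftarrow>walk_edges p. edge_cost n e) = 2 * real (length (walk_edges p))
      - real (length (filter (\<lambda>e. e \<in> rim_edges n) (walk_edges p)))"
    by (rule inner_cost[OF inner])
  finally show ?thesis
    using assms len by (simp add: count_rim_edges length_walk_edges of_nat_diff)
qed

text \<open>The path has n - 1 inner edges, and leaving the rim even once loses at least one of
  them. This gap of one separates the routes that the cut binds from those where it is void.\<close>

lemma rim_edges_count_cases:
  assumes "n \<ge> 2" and p: "p \<in> permutations_of_set (customers n)"
  shows "if successively (\<lambda>i j. {i, j} \<in> rim_edges n) p
         then (\<Sum>e\<in>rim_edges n. real (route_vector p e)) = real n - 1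
         else (\<Sum>e\<in>rim_edges n. real (route_vector p e)) \<le> real n - 2"
proof -
  have "distinct p" "set p = customers n"
    using p by (auto simp: permutations_of_set_def)
  then have "length p = n"
    using distinct_card[of p] by (simp add: customers_def)
  then have len: "length (walk_edges p) = n - 1"
    by (simp add: length_walk_edges)
  show ?thesis
  proof (cases "set (walk_edges p) \<subseteq> rim_edges n")
    case True
    then have "filter (\<lambda>e. e \<in> rim_edges n) (walk_edges p) = walk_edges p"
      by (auto intro!: filter_True)
    then show ?thesis
      using True len assms by (simp add: walk_edges_subset_iff[symmetric] count_rim_edges of_nat_diff)
  next
    case False
    then obtain e where "e \<in> set (walk_edges p)" "e \<notin> rim_edges n" by auto
    then have "length (filter (\<lambda>e. e \<in> rim_edges n) (walk_edges p)) < length (walk_edges p)"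
      by (rule length_filter_less)
    then show ?thesis
      using False len assms by (simp add: walk_edges_subset_iff[symmetric] count_rim_edges)
  qed
qed

section \<open>Bounds on the recourse cost\<close>

lemma finite_set_pmf_demands: "finite (set_pmf (demands n \<mu>))"
  unfolding demands_def
  by (rule finite_subset[OF set_Pi_pmf_subset']) (auto simp: customers_def intro!: finite_PiE_dflt)

lemma demand_range:
  assumes "\<xi> \<in> set_pmf (demands n \<mu>)"
  shows "\<xi> i \<in> {0, 1}"
  using assms unfolding demands_def
  by (subst (asm) set_Pi_pmf) (force simp: customers_def PiE_dflt_def)+

lemma visit_cost_nonneg:
  assumes "\<And>q. G q \<ge> 0"
  shows "visit_cost n \<mu> G i q \<ge> 0"
  unfolding visit_cost_def
  by (intro integral_nonneg_AE AE_pmfI) (simp add: failure_cost_def Psi_def assms)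

lemma cost_to_go_nonneg: "cost_to_go n \<mu> ks i q \<ge> 0"
  by (induction ks arbitrary: i q)
    (auto simp: preventive_cost_def edge_cost_def visit_cost_nonneg)

lemma recourse_nonneg: "recourse n \<mu> p \<ge> 0"
  by (simp add: recourse_def cost_to_go_nonneg)

text \<open>A demand of 0 or 1 cannot exceed a load of at least 1, so \<open>Psi\<close> vanishes
  and the next load is \<open>q\<close> or \<open>q - 1\<close>. The expectation thus averages
  values of \<open>G\<close> at these two loads only.\<close>

lemma visit_cost_le:
  assumes "n \<ge> 2" "q \<ge> 1" "G q \<le> c" "G (q - 1) \<le> c"
  shows "visit_cost n \<mu> G k q \<le> c"
proof -
  have "failure_cost k * real_of_int (Psi n (\<xi> k) q) + G (Psi n (\<xi> k) q * capacity n + q - \<xi> k) \<le> c"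
    if "\<xi> \<in> set_pmf (demands n \<mu>)" for \<xi>
  proof -
    have "\<xi> k = 0 \<or> \<xi> k = 1" using demand_range[OF that] by simp
    moreover have "Psi n (\<xi> k) q = 0" if "\<xi> k \<le> q"
      using that \<open>n \<ge> 2\<close> by (simp add: Psi_def capacity_def ceiling_le_iff divide_simps)
    ultimately show ?thesis using assms by auto
  qed
  then show ?thesis
    unfolding visit_cost_def
    by (intro measure_pmf.integral_le_const integrable_measure_pmf_finite finite_set_pmf_demands
        AE_pmfI)
qed

text \<open>Each visit lowers the load and the number of remaining customers by at most and exactly
  one respectively, so the load suffices to the end and never returning is free.\<close>

lemma cost_to_go_no_failure:
  "n \<ge> 2 \<Longrightarrow> int (length ks) \<le> q \<Longrightarrow> cost_to_go n \<mu> ks i q \<le> 0"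
  by (induction ks arbitrary: i q) (auto intro!: min.coboundedI1 visit_cost_le)

text \<open>Returning at once costs at most 1, and the full load n - 1 then covers all remaining
  customers, whatever \<open>q\<close> was.\<close>

lemma cost_to_go_restock:
  assumes "n \<ge> 2" "length ks \<le> n - 1"
  shows "cost_to_go n \<mu> ks i q \<le> 1"
proof (cases ks)
  case (Cons k ks')
  have "visit_cost n \<mu> (cost_to_go n \<mu> ks' k) k (capacity n) \<le> 0"
    using assms Cons by (intro visit_cost_le cost_to_go_no_failure) (auto simp: capacity_def)
  moreover have "preventive_cost n i k \<le> 1"
    by (simp add: preventive_cost_def edge_cost_def)
  ultimately show ?thesis
    unfolding Cons cost_to_go.simps by (intro min.coboundedI2) linarith
qed simp

lemma recourse_le_1:
  assumes "n \<ge> 2" "length p = n"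
  shows "recourse n \<mu> p \<le> 1"
proof -
  obtain k ks where p: "p = k # ks" using assms by (cases p) auto
  have "cost_to_go n \<mu> p 0 (capacity n) \<le> 1"
    unfolding p cost_to_go.simps using assms p
    \<comment> \<open>The full vehicle serves the first customer without failure, which leaves n - 1
      customers. One orientation suffices, as \<open>recourse\<close> is a minimum.\<close>
    by (intro min.coboundedI1 visit_cost_le cost_to_go_restock) (auto simp: capacity_def)
  then show ?thesis by (simp add: recourse_def)
qed

section \<open>Partitions into paths\<close>

lemma path_partitions_1:
  assumes "S \<noteq> {}"
  shows "\<pi> \<in> path_partitions n \<mu> f S ES 1 \<longleftrightarrow>
    (\<exists>p. \<pi> = {p} \<and> feasible_path n \<mu> f p \<and> successively (\<lambda>i j. {i, j} \<in> ES) p \<and> set p = S)"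
  by (auto simp: path_partitions_def card_1_singleton_iff disjoint_family_on_def)

text \<open>Some partition exists, so the \<open>LEAST\<close> is attained, and it is not 0 because
  no paths cover only the empty set.\<close>

lemma min_paths_ge_1:
  assumes "S \<noteq> {}" "path_partitions n \<mu> f S ES m \<noteq> {}"
  shows "1 \<le> min_paths n \<mu> f S ES"
proof -
  have "path_partitions n \<mu> f S ES (min_paths n \<mu> f S ES) \<noteq> {}"
    unfolding min_paths_def using assms(2) by (rule LeastI)
  moreover have "path_partitions n \<mu> f S ES 0 = {}"
    using assms(1) by (auto simp: path_partitions_def)
  ultimately show ?thesis by (cases "min_paths n \<mu> f S ES") auto
qed

theorem theorem6:
  fixes n :: nat and \<mu> f :: real
  assumes "n \<ge> 4"
    and "0 < \<mu>" and "\<mu> < 1"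
    and "f \<ge> real n * \<mu> / real_of_int (capacity n)"
  shows "\<exists>S ES m L. is_E_cut n \<mu> f S ES m L \<and>
           is_minimum
             {rmp_objective n x \<theta> | x \<theta>. (x, \<theta>) \<in> rmp_points n \<mu> f \<and> satisfies_E_cut S ES m L x \<theta>}
             (vrpsd_value n \<mu> f)"
proof -
  define rim where "rim p \<longleftrightarrow> successively (\<lambda>i j. {i, j} \<in> rim_edges n) p" for p
  define Ps where "Ps = permutations_of_set (customers n)"
  define R where "R p = (\<Sum>e\<in>rim_edges n. real (route_vector p e))" for p
  define L where "L = Min (recourse n \<mu> ` {p \<in> Ps. rim p})"
  have n2: "n \<ge> 2" using assms by simp
  have cust: "customers n \<noteq> {}" "finite (customers n)" "card (customers n) = n" "1 \<in> customers n"
    using assms by (auto simp: customers_def)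
  have feas: "feasible_path n \<mu> f p" if "p \<in> Ps" for p
    using that assms cust by (subst feasible_path_iff) (auto simp: Ps_def permutations_of_set_def)
  have sol: "is_solution n \<mu> f x p \<longleftrightarrow> p \<in> Ps \<and> x = route_vector p" for x p
    using feas by (auto simp: is_solution_def Ps_def)
  have travel: "travel_cost n (route_vector p) = 2 * real n - R p" if "p \<in> Ps" for p
    using travel_cost_route_vector[OF n2] that by (simp add: Ps_def R_def)
  have R: "R p = real n - 1 \<and> rim p \<or> R p \<le> real n - 2 \<and> \<not> rim p" if "p \<in> Ps" for p
    using rim_edges_count_cases[OF n2, of p] that by (auto simp: Ps_def R_def rim_def split: if_splits)
  have finPs: "finite Ps"
    using cust by (simp add: Ps_def)
  \<comment> \<open>The order 1, ..., n shows that \<open>L\<close> is a minimum over a nonempty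
    set.\<close>
  have upt: "[1..<Suc n] \<in> {p \<in> Ps. rim p}"
    using successively_rim_upt[of n]
    by (auto simp: Ps_def rim_def permutations_of_set_def customers_def simp del: upt_Suc)
  have "L \<in> recourse n \<mu> ` {p \<in> Ps. rim p}"
    unfolding L_def using finPs upt by (intro Min_in) auto
  then obtain p0 where p0: "p0 \<in> Ps" "rim p0" "recourse n \<mu> p0 = L" by auto
  have L_le: "L \<le> recourse n \<mu> p" if "p \<in> Ps" "rim p" for p
    unfolding L_def using finPs that by (intro Min_le) auto
  have L0: "0 \<le> L"
    using p0 recourse_nonneg[of n \<mu> p0] by simp
  have "L \<le> recourse n \<mu> [1..<Suc n]"
    using upt by (intro L_le) auto
  also have "\<dots> \<le> 1"
    by (intro recourse_le_1 n2) simp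
  finally have L1: "L \<le> 1" .
  \<comment> \<open>Rim paths have travel cost 2n - (n - 1) = n + 1 and recourse at least
    \<open>L\<close>. All others travel for at least n + 2, which is no less than n + 1 +
    \<open>L\<close>.\<close>
  have opt_value: "vrpsd_value n \<mu> f = real n + 1 + L"
    unfolding vrpsd_value_def
  proof (rule Min_eqI)
    have "{travel_cost n x + recourse n \<mu> p | x p. is_solution n \<mu> f x p}
        = (\<lambda>p. travel_cost n (route_vector p) + recourse n \<mu> p) ` Ps"
      by (auto simp: sol)
    then show "finite {travel_cost n x + recourse n \<mu> p | x p. is_solution n \<mu> f x p}"
      using finPs by simp
  next
    fix y assume "y \<in> {travel_cost n x + recourse n \<mu> p | x p. is_solution n \<mu> f x p}"
    then obtain p where p: "p \<in> Ps" "y = 2 * real n - R p + recourse n \<mu> p"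
      by (auto simp: sol travel)
    then show "real n + 1 + L \<le> y"
      using R[of p] L_le[of p] L1 recourse_nonneg[of n \<mu> p] by auto
  next
    have "real n + 1 + L = travel_cost n (route_vector p0) + recourse n \<mu> p0"
      using p0 R[of p0] travel[of p0] by simp
    then show "real n + 1 + L \<in> {travel_cost n x + recourse n \<mu> p | x p. is_solution n \<mu> f x p}"
      using p0 sol by blast
  qed
  \<comment> \<open>Single-path partitions are the Hamiltonian rim paths over which \<open>L\<close>
    was minimized, so \<open>L\<close> is an admissible coefficient.\<close>
  have part: "\<pi> \<in> path_partitions n \<mu> f (customers n) (rim_edges n) 1 \<longleftrightarrow> (\<exists>p\<in>Ps. \<pi> = {p} \<and> rim p)" for \<pi>
    unfolding path_partitions_1[OF cust(1)] rim_def using feas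
    by (auto simp: Ps_def permutations_of_set_def feasible_path_def)
  \<comment> \<open>The factor \<open>R p - n + 2\<close> is 1 for rim paths and at most 0
    otherwise.\<close>
  have cut: "satisfies_E_cut (customers n) (rim_edges n) 1 L (route_vector p) \<theta>
      \<longleftrightarrow> (\<Sum>i\<in>customers n. \<theta> i) \<ge> L * (R p - real n + 2)" for p \<theta>
    by (simp add: satisfies_E_cut_def R_def cust add.commute add.left_commute)
  have "is_E_cut n \<mu> f (customers n) (rim_edges n) 1 L"
    unfolding is_E_cut_def
  proof (intro conjI)
    have "{p0} \<in> path_partitions n \<mu> f (customers n) (rim_edges n) 1"
      using part p0 by blast
    then show "1 \<le> min_paths n \<mu> f (customers n) (rim_edges n)"
      using cust(1) by (intro min_paths_ge_1) auto
    show "ereal L \<le> recourse_bound n \<mu> f (customers n) (rim_edges n) 1"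
      unfolding recourse_bound_def using part L_le by (intro INF_greatest) auto
  qed (use cust L0 rim_edges_within[OF n2] in auto)
  moreover have "is_minimum
      {rmp_objective n x \<theta> | x \<theta>. (x, \<theta>) \<in> rmp_points n \<mu> f
         \<and> satisfies_E_cut (customers n) (rim_edges n) 1 L x \<theta>} (vrpsd_value n \<mu> f)"
    unfolding is_minimum_def opt_value
  proof
    \<comment> \<open>Cut and objective see only the sum of \<theta>, so all of \<open>L\<close> may
      be put on one customer.\<close>
    define \<theta> where "\<theta> i = (if i = 1 then L else 0)" for i :: nat
    have sum_\<theta>: "(\<Sum>i\<in>customers n. \<theta> i) = L"
      using cust by (simp add: \<theta>_def)
    have "(route_vector p0, \<theta>) \<in> rmp_points n \<mu> f"
      using p0 sol L0 by (auto simp: rmp_points_def feasible_solutions_def \<theta>_def)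
    moreover have "satisfies_E_cut (customers n) (rim_edges n) 1 L (route_vector p0) \<theta>"
      unfolding cut sum_\<theta> using p0 R[of p0] by simp
    moreover have "real n + 1 + L = rmp_objective n (route_vector p0) \<theta>"
      using p0 R[of p0] by (simp add: rmp_objective_def travel sum_\<theta>)
    ultimately show "real n + 1 + L \<in> {rmp_objective n x \<theta> | x \<theta>. (x, \<theta>) \<in> rmp_points n \<mu> f
         \<and> satisfies_E_cut (customers n) (rim_edges n) 1 L x \<theta>}"
      by blast
  next
    have "real n + 1 + L \<le> rmp_objective n x \<theta>"
      if pt: "(x, \<theta>) \<in> rmp_points n \<mu> f" "satisfies_E_cut (customers n) (rim_edges n) 1 L x \<theta>" for x \<theta>
    proof -
      obtain p where p: "p \<in> Ps" "x = route_vector p"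
        using pt by (auto simp: rmp_points_def feasible_solutions_def sol)
      have "0 \<le> (\<Sum>i\<in>customers n. \<theta> i)"
        using pt by (intro sum_nonneg) (auto simp: rmp_points_def)
      moreover have "L * (R p - real n + 2) \<le> (\<Sum>i\<in>customers n. \<theta> i)"
        using pt(2) unfolding p(2) cut .
      ultimately show ?thesis
        using R[OF p(1)] L1 p by (auto simp: rmp_objective_def travel)
    qed
    then show "\<forall>u\<in>{rmp_objective n x \<theta> | x \<theta>. (x, \<theta>) \<in> rmp_points n \<mu> f
         \<and> satisfies_E_cut (customers n) (rim_edges n) 1 L x \<theta>}. real n + 1 + L \<le> u"
      by blast
  qed
  ultimately show ?thesis by blast
qed

end
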